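(* Let $u_1,u_2,u_3,\ldots$ be an enumeration without repetitions of all rational points in the half-open cube $(0,1]^n$, such that $r\le s$ implies $\mathrm{den}(u_r)\le\mathrm{den}(u_s)$. Then the sequence $(u_r)$ is uniformly distributed in $(0,1]^n$. The same statement holds if $(0,1]^n$ is replaced by the closed cube $[0,1]^n$ throughout.
   Context: Every $u\in\mathbb{Q}^n$ can be written uniquely as $u=(a_1/k,\ldots,a_n/k)$ with $a_1,\ldots,a_n,k$ integers, $k\ge1$, and $\gcd(a_1,\ldots,a_n,k)=1$; then $k=\mathrm{den}(u)$ is the denominator of $u$. For $X$ equal to $(0,1]^n$ or $[0,1]^n$, a sequence $(u_r)_{r\ge1}$ in $X$ is uniformly distributed if for every Riemann-integrable $f:X\to\mathbb{C}$ we have $\lim_{s\to\infty}\frac1s\sum_{r=1}^s f(u_r)=\int_X f\,d\bar x$. *)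

theory Defs
  imports "HOL-Analysis.Analysis"
begin

definition rational_points :: "(real ^ 'n) set" where
  "rational_points = {u. \<forall>i. u $ i \<in> \<rat>}"

definition is_den :: "real ^ 'n \<Rightarrow> nat \<Rightarrow> bool" where
  "is_den u k \<longleftrightarrow> k \<ge> 1 \<and>
     (\<exists>a :: 'n \<Rightarrow> int. (\<forall>i. u $ i = real_of_int (a i) / real k) \<and>
        Gcd (insert (int k) (range a)) = 1)"

text \<open>Unspecified unless \<open>u\<close> is rational; see \<open>is_den_den\<close> below.\<close>

definition den :: "real ^ 'n \<Rightarrow> nat" where
  "den u = (THE k. is_den u k)"

lemma is_den_ex:
  fixes u :: "real ^ 'n"
  assumes "u \<in> rational_points"
  shows "\<exists>k. is_den u k"
proof -
  define P where "P k \<longleftrightarrow> k \<ge> 1 \<and> (\<exists>a :: 'n \<Rightarrow> int. \<forall>i. u $ i = real_of_int (a i) / real k)"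
    for k :: nat
  have "\<exists>p q. q > 0 \<and> u $ i = real_of_int p / real_of_int q" for i
    using assms unfolding rational_points_def
    by (metis (no_types, lifting) Rats_cases' mem_Collect_eq)
  then obtain p q where pq: "\<And>i. q i > 0" "\<And>i. u $ i = real_of_int (p i) / real_of_int (q i)"
    by metis
  define m where "m = (\<Prod>i\<in>UNIV. q i)"
  have m: "m > 0"
    unfolding m_def using pq(1) by (simp add: prod_pos)
  have "u $ i = real_of_int (p i * (m div q i)) / real (nat m)" for i
  proof -
    have "q i dvd m"
      unfolding m_def by (rule dvd_prodI) auto
    then obtain c where c: "m = q i * c" by (rule dvdE)
    have "c > 0"
      using m pq(1)[of i] unfolding c by (simp add: zero_less_mult_iff)
    moreover have "m div q i = c"
      using pq(1)[of i] c by simp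
    moreover have "real (nat m) = real_of_int (q i) * real_of_int c"
      using m c by simp
    ultimately show ?thesis
      by (simp add: pq(2)[of i])
  qed
  then have "P (nat m)"
    unfolding P_def using m by (intro conjI exI[of _ "\<lambda>i. p i * (m div q i)"]) auto
  define k where "k = (LEAST k. P k)"
  have Pk: "P k" unfolding k_def using \<open>P (nat m)\<close> by (rule LeastI)
  then obtain a where k: "k \<ge> 1" and a: "\<And>i. u $ i = real_of_int (a i) / real k"
    unfolding P_def by blast
  define g where "g = Gcd (insert (int k) (range a))"
  have g0: "g \<ge> 0" unfolding g_def by simp
  have gk: "g dvd int k" unfolding g_def by (rule Gcd_dvd) simp
  have ga: "g dvd a i" for i unfolding g_def by (rule Gcd_dvd) simp
  have gpos: "g > 0" using gk g0 k by (cases "g = 0") auto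
  obtain c where c: "int k = g * c" using gk by (rule dvdE)
  have "g * c > 0" using c k by linarith
  then have cpos: "c > 0" using gpos by (simp add: zero_less_mult_iff)
  have rk: "real k = real_of_int g * real_of_int c"
    using c by (metis of_int_mult of_int_of_nat_eq)
  have "u $ i = real_of_int (a i div g) / real (nat c)" for i
  proof -
    obtain b where "a i = g * b" using ga by (rule dvdE)
    moreover from this have "a i div g = b" using gpos by simp
    ultimately show ?thesis using gpos cpos by (simp add: a[of i] rk)
  qed
  then have "P (nat c)"
    unfolding P_def using cpos by (intro conjI exI[of _ "\<lambda>i. a i div g"]) auto
  then have "k \<le> nat c" unfolding k_def by (rule Least_le)
  then have "g * c \<le> c" using c cpos by linarith
  then have "g = 1" using gpos cpos by simp
  then have "is_den u k"
    unfolding is_den_def using k a by (intro conjI exI[of _ a]) (auto simp: g_def)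
  then show ?thesis by (rule exI)
qed

lemma is_den_dvd:
  assumes "is_den u k" "is_den u l"
  shows "k dvd l"
proof -
  obtain a where k: "k \<ge> 1" and a: "\<And>i. u $ i = real_of_int (a i) / real k"
    and G: "Gcd (insert (int k) (range a)) = 1"
    using assms(1) unfolding is_den_def by blast
  obtain b where l: "l \<ge> 1" and b: "\<And>i. u $ i = real_of_int (b i) / real l"
    using assms(2) unfolding is_den_def by blast
  have ab: "int l * a i = int k * b i" for i
  proof -
    have "real_of_int (a i) / real k = real_of_int (b i) / real l"
      using a b by metis
    then have "real l * real_of_int (a i) = real k * real_of_int (b i)"
      using k l by (simp add: frac_eq_eq mult.commute)
    then have "real_of_int (int l * a i) = real_of_int (int k * b i)" by simp
    then show ?thesis by (simp only: of_int_eq_iff)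
  qed
  have "int k dvd Gcd ((*) (int l) ` insert (int k) (range a))"
    by (rule Gcd_greatest) (auto simp: ab)
  also have "\<dots> = int l" by (simp only: Gcd_mult G) simp
  finally show ?thesis by simp
qed

lemma is_den_den:
  assumes "u \<in> rational_points"
  shows "is_den u (den u)"
proof -
  have "\<exists>!k. is_den u k"
    using is_den_ex[OF assms] is_den_dvd dvd_antisym by blast
  then show ?thesis unfolding den_def by (rule theI')
qed

text \<open>The Riemann integral, obtained from the gauge integral of the library by allowing only
  gauges of constant radius \<open>d\<close>, that is, by bounding the mesh of the tagged divisions.
  A function on a bounded set \<open>X\<close> is extended by zero to a nondegenerate box containing \<open>X\<close>.
  In particular a function on a half-open cube has to be bounded to be integrable; there are no
  improper integrals.\<close>

definition has_riemann_integral_cbox ::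
  "('a::euclidean_space \<Rightarrow> 'b::real_normed_vector) \<Rightarrow> 'b \<Rightarrow> 'a \<Rightarrow> 'a \<Rightarrow> bool" where
  "has_riemann_integral_cbox f I a b \<longleftrightarrow>
     (\<forall>e>0. \<exists>d>0. \<forall>p. p tagged_division_of cbox a b \<and> (\<lambda>x. ball x d) fine p \<longrightarrow>
        norm ((\<Sum>(x,K)\<in>p. measure lborel K *\<^sub>R f x) - I) < e)"

definition has_riemann_integral ::
  "('a::euclidean_space \<Rightarrow> 'b::real_normed_vector) \<Rightarrow> 'b \<Rightarrow> 'a set \<Rightarrow> bool" where
  "has_riemann_integral f I X \<longleftrightarrow>
     (\<exists>a b. X \<subseteq> cbox a b \<and> box a b \<noteq> {} \<and>
        has_riemann_integral_cbox (\<lambda>x. if x \<in> X then f x else 0) I a b)"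

definition riemann_integrable_on ::
  "('a::euclidean_space \<Rightarrow> 'b::real_normed_vector) \<Rightarrow> 'a set \<Rightarrow> bool"
  (infixr "riemann'_integrable'_on" 46) where
  "f riemann_integrable_on X \<longleftrightarrow> (\<exists>I. has_riemann_integral f I X)"

text \<open>Hence the library's \<open>integral X f\<close> is the value of the Riemann integral.\<close>

lemma has_riemann_integral_imp_has_integral:
  fixes f :: "'a::euclidean_space \<Rightarrow> 'b::banach"
  assumes "has_riemann_integral f I X"
  shows "(f has_integral I) X"
proof -
  obtain a b where X: "X \<subseteq> cbox a b"
    and I: "has_riemann_integral_cbox (\<lambda>x. if x \<in> X then f x else 0) I a b"
    using assms unfolding has_riemann_integral_def by blast
  have "((\<lambda>x. if x \<in> X then f x else 0) has_integral I) (cbox a b)"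
    unfolding has_integral
  proof (intro allI impI)
    fix e :: real assume "e > 0"
    then obtain d where "d > 0" and
      "\<forall>p. p tagged_division_of cbox a b \<and> (\<lambda>x. ball x d) fine p \<longrightarrow>
         norm ((\<Sum>(x,K)\<in>p. measure lborel K *\<^sub>R (if x \<in> X then f x else 0)) - I) < e"
      using I[unfolded has_riemann_integral_cbox_def, rule_format, of e] by auto
    then show "\<exists>\<gamma>. gauge \<gamma> \<and> (\<forall>\<D>. \<D> tagged_division_of cbox a b \<and> \<gamma> fine \<D> \<longrightarrow>
        norm ((\<Sum>(x,K)\<in>\<D>. measure lborel K *\<^sub>R (if x \<in> X then f x else 0)) - I) < e)"
      by (intro exI[of _ "\<lambda>x. ball x d"] conjI gauge_ball)
  qed
  then show ?thesis
    by (rule has_integral_restrict[OF X, THEN iffD1])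
qed

text \<open>Sequences are indexed by the integers \<open>r \<ge> 1\<close>; the value at \<open>0\<close> is irrelevant.\<close>

definition uniformly_distributed :: "(nat \<Rightarrow> 'a::euclidean_space) \<Rightarrow> 'a set \<Rightarrow> bool" where
  "uniformly_distributed u X \<longleftrightarrow>
     (\<forall>r\<ge>1. u r \<in> X) \<and>
     (\<forall>f :: 'a \<Rightarrow> complex. f riemann_integrable_on X \<longrightarrow>
        (\<lambda>s. (\<Sum>r=1..s. f (u r)) / of_nat s) \<longlonglongrightarrow> integral X f)"

definition half_open_cube :: "(real ^ 'n) set" where
  "half_open_cube = {x. \<forall>i. 0 < x $ i \<and> x $ i \<le> 1}"

definition closed_cube :: "(real ^ 'n) set" where
  "closed_cube = {x. \<forall>i. 0 \<le> x $ i \<and> x $ i \<le> 1}"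

end

(* Write g = f - I. Riemann sums over the grid show that the sum of g over the points x with m x
   integral is o(m^n). These points are the disjoint union over d | m of the points of denominator
   d, so if F(N) is the sum of g over all points of denominator at most N, then
   sum_{j <= N} F(N div j) = o(N^(n+1)). Since sum_{j >= 2} 1/j^2 < 1, the term j = 1 dominates and
   F(N) = o(N^(n+1)); this replaces Moebius inversion. The same relation for the constant function
   1 gives at least c N^(n+1) points of denominator at most N, while there are only O(k^n) points
   of denominator k, so an initial segment that ends inside a block of equal denominators differs
   negligibly from one that contains the whole block. *)

theory Submission
  imports Defs
begin

section \<open>Sums over \<open>N div j\<close>\<close>

text \<open>The divisor relation for a single m mixes blocks of very different sizes. Summed over m
  <= N and regrouped by j = m/d it contains F(N) once, against the values F(N div j) with j >= 2,
  whose total weight is at most sum_{j >= 2} 1/j^(n+1) < 1. This contraction starts only from the a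
  priori bound F(N) = O(N^(n+1)), hence from boundedness of f. Boundedness is not assumed; it is
  extracted from Riemann integrability, that is, from gauges of constant radius. The integral may be
  witnessed on any box containing X, while the grid fits only the unit cube, so the integral is
  first moved there. The half-open cube is the natural domain: its points x with m x integral are
  exactly the upper corners of the m^n cells of side 1/m. The closed cube adds only the points with
  some coordinate 0, which are O(m^(n-1)) in number. Both cubes are therefore handled together, as
  sets X with \<open>half_open_cube \<subseteq> X\<close> and
  \<open>X \<subseteq> closed_cube\<close>.\<close>

lemma sum_inverse_squares_tail:
  assumes "1 \<le> J"
  shows "(\<Sum>j\<in>{J<..N}. 1 / real j ^ 2) \<le> 1 / real J"
proof -
  \<comment> \<open>The subtracted term makes the induction telescope, by 1/(x+1)^2 <= 1/x -
    1/(x+1).\<close>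
  have "(\<Sum>j\<in>{J<..J+k}. 1 / real j ^ 2) \<le> 1 / real J - 1 / real (J + k)" for k
  proof (induction k)
    case (Suc k)
    have "{J<..J + Suc k} = insert (J + Suc k) {J<..J+k}" by auto
    then have "(\<Sum>j\<in>{J<..J + Suc k}. 1 / real j ^ 2) =
        1 / real (J + Suc k) ^ 2 + (\<Sum>j\<in>{J<..J+k}. 1 / real j ^ 2)" by simp
    moreover have "1 / real (J + Suc k) ^ 2 \<le> 1 / real (J + k) - 1 / real (J + Suc k)"
    proof -
      define x where "x = real (J + k)"
      have x: "x > 0" "real (J + Suc k) = x + 1" using assms by (auto simp: x_def)
      have "1 / (x + 1)^2 \<le> 1 / (x * (x + 1))"
        using x(1) by (intro divide_left_mono) (auto simp: power2_eq_square)
      also have "\<dots> = 1 / x - 1 / (x + 1)" using x(1) by (simp add: field_simps)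
      finally show ?thesis by (simp only: x(2) x_def)
    qed
    ultimately show ?case using Suc by linarith
  qed simp
  from this[of "N - J"] show ?thesis
    by (cases "J \<le> N") (auto simp: intro: order_trans)
qed

text \<open>Dirichlet's regrouping: with m = j * d, the pairs of m <= N and a divisor d become the
  lattice points under the hyperbola j * d <= N. The inner sum on the right is then a partial sum of
  \<open>a\<close>, evaluated at \<open>N div j\<close>.\<close>

lemma sum_sum_divisors:
  fixes a :: "nat \<Rightarrow> 'a::comm_monoid_add"
  shows "(\<Sum>m=1..N. \<Sum>d | d dvd m. a d) = (\<Sum>j=1..N. \<Sum>d=1..N div j. a d)"
proof -
  have "(\<Sum>m=1..N. \<Sum>d | d dvd m. a d) = (\<Sum>(m,d)\<in>(SIGMA m:{1..N}. {d. d dvd m}). a d)"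
    by (rule sum.Sigma) (auto intro: finite_divisors_nat)
  also have "\<dots> = (\<Sum>(j,d)\<in>(SIGMA j:{1..N}. {1..N div j}). a d)"
  proof -
    have 1: "1 \<le> m div d \<and> m div d \<le> N \<and> 1 \<le> d \<and> d \<le> N div (m div d)"
      if m: "1 \<le> m" "m \<le> N" "d dvd m" for m d
    proof -
      obtain c where c: "m = d * c" using m(3) by blast
      with m(1) have "c \<ge> 1" "d \<ge> 1" by (auto simp: Suc_le_eq intro!: Nat.gr0I)
      then show ?thesis
        using c m(2) by (auto simp: less_eq_div_iff_mult_less_eq mult.commute intro: order_trans[of _ m])
    qed
    have 2: "1 \<le> j * d \<and> j * d \<le> N"
      if "1 \<le> j" "1 \<le> d" "d \<le> N div j" for j d
      using that by (simp add: less_eq_div_iff_mult_less_eq mult.commute Suc_le_eq)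
    show ?thesis
      by (rule sum.reindex_bij_witness[of _ "\<lambda>(j,d). (j * d, d)" "\<lambda>(m,d). (m div d, d)"])
        (use 1 2 in fastforce)+
  qed
  also have "\<dots> = (\<Sum>j=1..N. \<Sum>d=1..N div j. a d)"
    by (rule sum.Sigma[symmetric]) auto
  finally show ?thesis .
qed

text \<open>The factor 1/j^p is weakened to 1/j^2, so that one convergent series serves every
  dimension.\<close>

lemma real_div_power_le:
  assumes "1 \<le> j" "2 \<le> p"
  shows "real (N div j) ^ p \<le> real N ^ p * (1 / real j ^ 2)"
proof -
  have "real (N div j) ^ p \<le> (real N / real j) ^ p"
    by (intro power_mono) (auto simp: of_nat_div_le_of_nat)
  also have "\<dots> = real N ^ p / real j ^ p" by (rule power_divide)
  also have "\<dots> \<le> real N ^ p / real j ^ 2"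
    using assms by (intro divide_left_mono power_increasing) auto
  finally show ?thesis by simp
qed

text \<open>Let L be the limsup of norm (F N) / N^p, finite by the a priori bound with
  \<open>M\<close>. Isolating j = 1 in the relation gives L <= 0 + (3/4) L, hence L = 0. The proof
  runs this as an iteration on eventual upper bounds.\<close>

lemma hyperbola_inversion_tendsto_0:
  fixes F G :: "nat \<Rightarrow> 'a::real_normed_vector"
  assumes p: "2 \<le> p"
    and G: "\<And>N. G N = (\<Sum>j=1..N. F (N div j))"
    and F: "\<And>N. norm (F N) \<le> M * real N ^ p"
    and lim: "(\<lambda>N. norm (G N) / real N ^ p) \<longlonglongrightarrow> 0"
  shows "(\<lambda>N. norm (F N) / real N ^ p) \<longlonglongrightarrow> 0"
proof -
  have M: "0 \<le> M" using F[of 1] norm_ge_zero[of "F 1"] by (simp del: norm_ge_zero)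
  \<comment> \<open>The factor is 7/8 = 3/4 + 1/16 + 1/16: the terms with j >= 2, then
    \<open>G\<close>, then the linear remainder \<open>C * real N\<close>.\<close>
  have step: "\<forall>\<^sub>F N in sequentially. norm (F N) \<le> (7/8 * L) * real N ^ p"
    if L: "L > 0" and ev: "\<forall>\<^sub>F N in sequentially. norm (F N) \<le> L * real N ^ p" for L
  proof -
    obtain N0 where N0: "\<And>N. N \<ge> N0 \<Longrightarrow> norm (F N) \<le> L * real N ^ p"
      using ev unfolding eventually_sequentially by blast
    define C where "C = M * real N0 ^ p"
    have C: "C \<ge> 0" unfolding C_def using M by simp
    have bd: "norm (F y) \<le> L * real y ^ p + C" for y
    proof (cases "y \<ge> N0")
      case False
      then have "M * real y ^ p \<le> C"
        unfolding C_def using M by (intro mult_left_mono power_mono) auto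
      then show ?thesis using F[of y] L by (smt (verit) mult_nonneg_nonneg of_nat_0_le_iff zero_le_power)
    qed (use N0[of y] C in linarith)
    have main: "norm (F N) \<le> norm (G N) + 3/4 * L * real N ^ p + C * real N" if "N \<ge> 1" for N
    proof -
      have "{1..N} = insert 1 {1<..N}" using that by auto
      then have "F N = G N - (\<Sum>j\<in>{1<..N}. F (N div j))" by (simp add: G)
      then have "norm (F N) \<le> norm (G N) + norm (\<Sum>j\<in>{1<..N}. F (N div j))"
        using norm_triangle_ineq4 by metis
      also have "norm (\<Sum>j\<in>{1<..N}. F (N div j)) \<le> (\<Sum>j\<in>{1<..N}. L * real N ^ p * (1 / real j ^ 2) + C)"
      proof (rule sum_norm_le)
        fix j assume "j \<in> {1<..N}"
        then have "L * real (N div j) ^ p \<le> L * (real N ^ p * (1 / real j ^ 2))"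
          using L p by (intro mult_left_mono real_div_power_le) auto
        then show "norm (F (N div j)) \<le> L * real N ^ p * (1 / real j ^ 2) + C"
          using bd[of "N div j"] by (simp add: mult.assoc)
      qed
      also have "\<dots> = L * real N ^ p * (\<Sum>j\<in>{1<..N}. 1 / real j ^ 2) + C * real (N - 1)"
        by (simp add: sum.distrib sum_distrib_left)
      also have "\<dots> \<le> L * real N ^ p * (3/4) + C * real N"
      proof (intro add_mono mult_left_mono)
        \<comment> \<open>The term j = 2 is kept exactly, giving 1/4 + 1/2. The tail bound from J =
          1 would give only 1, and no contraction.\<close>
        have "{1<..N} \<subseteq> insert 2 {2<..N}" by auto
        then have "(\<Sum>j\<in>{1<..N}. 1 / real j ^ 2) \<le> (\<Sum>j\<in>insert 2 {2<..N}. 1 / real j ^ 2)"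
          by (intro sum_mono2) auto
        also have "\<dots> \<le> 3/4" using sum_inverse_squares_tail[of 2 N] by simp
        finally show "(\<Sum>j\<in>{1<..N}. 1 / real j ^ 2) \<le> 3/4" .
      qed (use L C in auto)
      finally show ?thesis by (simp add: algebra_simps)
    qed
    have e1: "\<forall>\<^sub>F N in sequentially. norm (G N) / real N ^ p < L / 16"
      using lim L by (intro order_tendstoD(2)[of _ 0]) auto
    \<comment> \<open>From this N on, C <= (L/16) N, so the remainder \<open>C * real N\<close> is
      at most (L/16) N^2.\<close>
    have e2: "\<forall>\<^sub>F N in sequentially. real N \<ge> 16 * C / L"
      using filterlim_real_sequentially unfolding filterlim_at_top by blast
    show ?thesis
      using e1 e2 eventually_ge_at_top[of 1]
    proof eventually_elim
      case (elim N)
      have "norm (G N) \<le> L / 16 * real N ^ p"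
        using elim by (simp add: field_simps)
      moreover have "C * real N \<le> L / 16 * real N ^ p"
      proof -
        have "C * real N \<le> L / 16 * real N * real N"
          using elim L by (intro mult_right_mono) (auto simp: field_simps)
        also have "\<dots> = L / 16 * real N ^ 2" by (simp add: power2_eq_square)
        also have "\<dots> \<le> L / 16 * real N ^ p"
          using elim L p by (intro mult_left_mono power_increasing) auto
        finally show ?thesis .
      qed
      ultimately show ?case using main[of N] elim by (simp add: algebra_simps)
    qed
  qed
  have iter: "\<forall>\<^sub>F N in sequentially. norm (F N) \<le> ((7/8) ^ i * (M + 1)) * real N ^ p" for i
  proof (induction i)
    case 0
    \<comment> \<open>The iteration starts at \<open>M + 1\<close> since \<open>step\<close>
      requires a positive constant and \<open>M\<close> may be 0.\<close>
    have "norm (F N) \<le> (M + 1) * real N ^ p" for N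
      using F[of N] by (simp add: algebra_simps add_increasing)
    then show ?case by simp
  next
    case (Suc i)
    have "0 < (7/8) ^ i * (M + 1)" using M by simp
    from step[OF this Suc] show ?case by (simp only: power_Suc mult.assoc)
  qed
  show ?thesis
  proof (rule order_tendstoI)
    fix e :: real assume e: "0 < e"
    have "(\<lambda>i. (7/8) ^ i * (M + 1)) \<longlonglongrightarrow> 0"
      by (intro tendsto_mult_left_zero LIMSEQ_realpow_zero) auto
    then have "\<forall>\<^sub>F i in sequentially. (7/8) ^ i * (M + 1) < e"
      using e by (rule order_tendstoD(2))
    then obtain i where i: "(7/8) ^ i * (M + 1) < e"
      unfolding eventually_sequentially by blast
    show "\<forall>\<^sub>F N in sequentially. norm (F N) / real N ^ p < e"
      using iter[of i] eventually_ge_at_top[of 1]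
    proof eventually_elim
      case (elim N)
      then have "norm (F N) / real N ^ p \<le> (7/8) ^ i * (M + 1)"
        by (simp add: divide_le_eq)
      with i show ?case by linarith
    qed
  next
    fix e :: real assume "e < 0"
    then show "\<forall>\<^sub>F N in sequentially. e < norm (F N) / real N ^ p"
      by (intro always_eventually allI) (smt (verit) divide_nonneg_nonneg norm_ge_zero of_nat_0_le_iff zero_le_power)
  qed
qed

text \<open>Cut the sum at a fixed J. By monotonicity the first J terms are at most J * H N, and the
  terms beyond J add up to at most M N^p / J. For J >= 2 M / c the latter is at most half of the
  lower bound c N^p, so the other half is left for J * H N.\<close>

lemma hyperbola_lower_bound:
  fixes H :: "nat \<Rightarrow> real"
  assumes p: "2 \<le> p"
    and mono: "mono H"
    and nonneg: "\<And>N. 0 \<le> H N"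
    and H: "\<And>N. H N \<le> M * real N ^ p"
    and c: "c > 0" "\<And>N. c * real N ^ p \<le> (\<Sum>j=1..N. H (N div j))"
  shows "\<exists>c'>0. \<forall>N. c' * real N ^ p \<le> H N"
proof -
  have M: "0 \<le> M" using H[of 1] nonneg[of 1] by simp
  obtain J0 where J0: "2 * M / c < real J0" using reals_Archimedean2 by blast
  define J where "J = Suc J0"
  have J: "J \<ge> 1" "2 * M \<le> c * real J"
    using J0 c(1) unfolding J_def by (auto simp: field_simps)
  have "c / (2 * real J) * real N ^ p \<le> H N" for N
  proof -
    have "c * real N ^ p \<le> (\<Sum>j=1..N. H (N div j))" by (rule c)
    \<comment> \<open>If J > N, the first block runs past N; the additional terms are the
      nonnegative number \<open>H 0\<close>.\<close>
    also have "\<dots> \<le> (\<Sum>j\<in>{1..J} \<union> {J<..N}. H (N div j))"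
      by (intro sum_mono2) (auto simp: nonneg)
    also have "\<dots> = (\<Sum>j\<in>{1..J}. H (N div j)) + (\<Sum>j\<in>{J<..N}. H (N div j))"
      by (intro sum.union_disjoint) auto
    also have "(\<Sum>j\<in>{1..J}. H (N div j)) \<le> (\<Sum>j\<in>{1..J}. H N)"
      by (intro sum_mono monoD[OF mono]) simp
    also have "(\<Sum>j\<in>{J<..N}. H (N div j)) \<le> (\<Sum>j\<in>{J<..N}. M * (real N ^ p * (1 / real j ^ 2)))"
      using J p M
      by (intro sum_mono order_trans[OF H] mult_left_mono real_div_power_le) auto
    also have "\<dots> = M * real N ^ p * (\<Sum>j\<in>{J<..N}. 1 / real j ^ 2)"
      by (simp add: sum_distrib_left mult.assoc)
    also have "\<dots> \<le> M * real N ^ p * (1 / real J)"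
      using J M by (intro mult_left_mono sum_inverse_squares_tail) auto
    also have "\<dots> \<le> c / 2 * real N ^ p"
    proof -
      have "M / real J \<le> c / 2" using J by (simp add: field_simps)
      then have "M / real J * real N ^ p \<le> c / 2 * real N ^ p" by (intro mult_right_mono) auto
      then show ?thesis by simp
    qed
    finally have "c / 2 * real N ^ p \<le> real J * H N" by simp
    then show ?thesis using J(1) by (simp add: field_simps)
  qed
  then show ?thesis using c(1) J(1) by (intro exI[of _ "c / (2 * real J)"]) auto
qed

section \<open>Riemann sums over the grid\<close>

text \<open>A tag on the boundary of a cell may lie in a set that misses the interior of the cell,
  and would then contribute a stray function value. Retagging avoids this: a division that is fine
  for d/2 stays fine for d when each tag is moved within its cell. Cells without interior cannot be
  helped, but have content 0.\<close>

lemma tagged_division_interior_tags: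
  fixes a b :: "'a::euclidean_space"
  assumes "d > 0"
  obtains q where "q tagged_division_of cbox a b" "(\<lambda>x. ball x d) fine q"
    "\<And>x K. (x, K) \<in> q \<Longrightarrow> interior K \<noteq> {} \<Longrightarrow> x \<in> interior K"
proof -
  obtain q0 where q0: "q0 tagged_division_of cbox a b" "(\<lambda>x. ball x (d/2)) fine q0"
    using fine_division_exists[OF gauge_ball[of "d/2"]] assms by (metis half_gt_zero)
  note q0D = tagged_division_ofD[OF q0(1)]
  \<comment> \<open>The tag depends on the cell alone. Copies of a degenerate cell under different
    tags thus collapse, and distinct pairs of \<open>q\<close> have distinct cells.\<close>
  define t where "t K = (SOME x. x \<in> (if interior K = {} then K else interior K))" for K :: "'a set"
  have t: "t K \<in> (if interior K = {} then K else interior K)" if "(x, K) \<in> q0" for x K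
  proof -
    have "\<exists>y. y \<in> (if interior K = {} then K else interior K)"
      using q0D(2)[OF that] by (cases "interior K = {}") auto
    then show ?thesis unfolding t_def by (rule someI_ex)
  qed
  have t_in: "t K \<in> K" if "(x, K) \<in> q0" for x K
    using t[OF that] interior_subset[of K] by (auto split: if_splits)
  define q where "q = (\<lambda>K. (t K, K)) ` snd ` q0"
  have "q tagged_division_of cbox a b"
    unfolding tagged_division_of
  proof (intro conjI allI impI)
    show "finite q" unfolding q_def using q0D(1) by simp
    have "{K. \<exists>x. (x, K) \<in> q} = {K. \<exists>x. (x, K) \<in> q0}"
      unfolding q_def by (force simp: image_iff)
    then show "\<Union> {K. \<exists>x. (x, K) \<in> q} = cbox a b"
      using q0D(6) by simp
    fix x1 K1 x2 K2 assume as: "(x1, K1) \<in> q \<and> (x2, K2) \<in> q \<and> (x1, K1) \<noteq> (x2, K2)"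
    then obtain y1 y2 where "(y1, K1) \<in> q0" "(y2, K2) \<in> q0" "K1 \<noteq> K2"
      unfolding q_def by force
    then show "interior K1 \<inter> interior K2 = {}"
      using q0D(5) by blast
  qed (use q0D(3,4) t_in in \<open>force simp: q_def\<close>)+
  moreover have "(\<lambda>x. ball x d) fine q"
  proof (rule fineI)
    fix x K assume "(x, K) \<in> q"
    then obtain y where y: "(y, K) \<in> q0" "x = t K" unfolding q_def by force
    have "K \<subseteq> ball y (d/2)" using fineD[OF q0(2) y(1)] .
    moreover have "x \<in> K" using t_in y by simp
    ultimately show "K \<subseteq> ball x d"
      by (metis (no_types, opaque_lifting) subset_iff mem_ball dist_commute dist_triangle_half_l)
  qed
  moreover have "x \<in> interior K" if "(x, K) \<in> q" "interior K \<noteq> {}" for x K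
    using that t unfolding q_def by (force split: if_splits)
  ultimately show ?thesis by (rule that)
qed

text \<open>The cells outside \<open>cbox c d\<close> are tagged by interior points, where the integrand vanishes.\<close>

lemma has_riemann_integral_imp_cbox:
  fixes f :: "'a::euclidean_space \<Rightarrow> 'b::real_normed_vector"
  assumes f: "has_riemann_integral f I X" and X: "closure X = cbox c d" "box c d \<noteq> {}"
  shows "has_riemann_integral_cbox (\<lambda>x. if x \<in> X then f x else 0) I c d"
proof -
  define h where "h = (\<lambda>x. if x \<in> X then f x else 0)"
  obtain a b where ab: "X \<subseteq> cbox a b" and I: "has_riemann_integral_cbox h I a b"
    using f unfolding has_riemann_integral_def h_def by blast
  have sub: "cbox c d \<subseteq> cbox a b"
    using closure_minimal[OF ab closed_cbox] X by simp
  have "cbox c d \<noteq> {}" using X(2) box_subset_cbox by blast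
  \<comment> \<open>Each piece of \<open>P\<close> other than \<open>cbox c d\<close> receives a
    fixed fine tagged division \<open>q K\<close> with vanishing terms. Joined to an arbitrary fine
    \<open>p\<close> of \<open>cbox c d\<close>, these form a fine division of the outer box with
    the same Riemann sum, to which the hypothesis applies.\<close>
  then obtain P where P: "P division_of cbox a b" "cbox c d \<in> P"
    using partial_division_extend_1[OF sub] by metis
  note PD = division_ofD[OF P(1)]
  show ?thesis
    unfolding has_riemann_integral_cbox_def h_def[symmetric]
  proof (intro allI impI)
    fix e :: real assume "e > 0"
    then obtain \<delta> where \<delta>: "\<delta> > 0" and
      dI: "\<And>p. p tagged_division_of cbox a b \<Longrightarrow> (\<lambda>x. ball x \<delta>) fine p \<Longrightarrow>
         norm ((\<Sum>(x,K)\<in>p. measure lborel K *\<^sub>R h x) - I) < e"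
      using I[unfolded has_riemann_integral_cbox_def, rule_format, of e] by blast
    have "\<exists>q. q tagged_division_of K \<and> (\<lambda>x. ball x \<delta>) fine q \<and>
        (\<forall>(x,L)\<in>q. measure lborel L *\<^sub>R h x = 0)" if K: "K \<in> P - {cbox c d}" for K
    proof -
      obtain u v where uv: "K = cbox u v" using PD(4) K by blast
      obtain q where q: "q tagged_division_of cbox u v" "(\<lambda>x. ball x \<delta>) fine q"
        "\<And>x L. (x, L) \<in> q \<Longrightarrow> interior L \<noteq> {} \<Longrightarrow> x \<in> interior L"
        using tagged_division_interior_tags[OF \<delta>] by metis
      have "measure lborel L *\<^sub>R h x = 0" if xL: "(x, L) \<in> q" for x L
      proof (cases "interior L = {}")
        case True
        obtain r s where "L = cbox r s" using tagged_division_ofD(4)[OF q(1) xL] by blast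
        with True show ?thesis by (simp add: content_eq_0_interior)
      next
        case False
        have "L \<subseteq> K" using tagged_division_ofD(3)[OF q(1) xL] uv by simp
        then have "x \<in> interior K" using q(3)[OF xL False] interior_mono by blast
        \<comment> \<open>An open set that misses \<open>box c d\<close> misses its closure
          \<open>cbox c d\<close> as well, and X lies in there.\<close>
        moreover have "interior K \<inter> interior (cbox c d) = {}"
          using PD(5)[of K "cbox c d"] K P(2) by auto
        then have "interior K \<inter> cbox c d = {}"
          using open_Int_closure_eq_empty[of "interior K" "box c d"] X(2) by simp
        then have "interior K \<inter> X = {}"
          using closure_subset[of X] X(1) by blast
        ultimately show ?thesis by (auto simp: h_def)
      qed
      then show ?thesis using q uv by blast
    qed
    then obtain q where q: "\<And>K. K \<in> P - {cbox c d} \<Longrightarrow> q K tagged_division_of K \<and>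
        (\<lambda>x. ball x \<delta>) fine q K \<and> (\<forall>(x,L)\<in>q K. measure lborel L *\<^sub>R h x = 0)"
      by metis
    have "norm ((\<Sum>(x,K)\<in>p. measure lborel K *\<^sub>R h x) - I) < e"
      if p: "p tagged_division_of cbox c d" "(\<lambda>x. ball x \<delta>) fine p" for p
    proof -
      define q' where "q' = q(cbox c d := p)"
      have q': "q' K tagged_division_of K" "(\<lambda>x. ball x \<delta>) fine q' K" if "K \<in> P" for K
        using that q p unfolding q'_def by (cases "K = cbox c d"; simp)+
      have tag: "\<Union> (q' ` P) tagged_division_of \<Union> P"
        using q' PD by (intro tagged_division_Union) auto
      have "(\<Sum>(x,K)\<in>\<Union> (q' ` P). measure lborel K *\<^sub>R h x) = (\<Sum>(x,K)\<in>p. measure lborel K *\<^sub>R h x)"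
      proof (rule sum.mono_neutral_right)
        show "finite (\<Union> (q' ` P))" using tag by auto
        show "p \<subseteq> \<Union> (q' ` P)" using P(2) by (auto simp: q'_def)
        show "\<forall>z\<in>\<Union> (q' ` P) - p. (case z of (x, K) \<Rightarrow> measure lborel K *\<^sub>R h x) = 0"
        proof
          fix z assume "z \<in> \<Union> (q' ` P) - p"
          then obtain K where "K \<in> P - {cbox c d}" "z \<in> q K"
            by (auto simp: q'_def split: if_splits)
          then show "(case z of (x, K) \<Rightarrow> measure lborel K *\<^sub>R h x) = 0"
            using q[of K] by (cases z) auto
        qed
      qed
      moreover have "(\<lambda>x. ball x \<delta>) fine \<Union> (q' ` P)"
        using q'(2) by (auto simp: fine_def)
      ultimately show ?thesis using dI[of "\<Union> (q' ` P)"] tag PD(6) by simp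
    qed
    then show "\<exists>\<delta>>0. \<forall>p. p tagged_division_of cbox c d \<and> (\<lambda>x. ball x \<delta>) fine p \<longrightarrow>
        norm ((\<Sum>(x,K)\<in>p. measure lborel K *\<^sub>R h x) - I) < e"
      using \<delta> by blast
  qed
qed

section \<open>The unit cube cut into cells of side 1/m\<close>

text \<open>A cell is indexed by its upper corner, so that the indices 1, ..., m in each coordinate
  match the lattice points of the half-open cube.\<close>

definition grid_cell :: "nat \<Rightarrow> ('n \<Rightarrow> nat) \<Rightarrow> (real ^ 'n) set" where
  "grid_cell m a = cbox (\<chi> i. (real (a i) - 1) / real m) (\<chi> i. real (a i) / real m)"

abbreviation grid :: "nat \<Rightarrow> ('n \<Rightarrow> nat) set" where
  "grid m \<equiv> Pi UNIV (\<lambda>_. {1..m})"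

lemma finite_Pi_UNIV:
  fixes S :: "'b set"
  assumes "finite S"
  shows "finite (Pi (UNIV :: 'n::finite set) (\<lambda>_. S))"
  using assms by (simp add: PiE_UNIV_domain[symmetric] finite_PiE)

lemma card_Pi_UNIV: "card (Pi (UNIV :: 'n::finite set) (\<lambda>_. S)) = card S ^ CARD('n)"
  by (simp add: PiE_UNIV_domain[symmetric] card_PiE)

lemma mem_grid_cell:
  "x \<in> grid_cell m a \<longleftrightarrow> (\<forall>i. (real (a i) - 1) / real m \<le> x $ i \<and> x $ i \<le> real (a i) / real m)"
  by (simp add: grid_cell_def mem_box_cart)

definition grid_point :: "nat \<Rightarrow> ('n \<Rightarrow> nat) \<Rightarrow> real ^ 'n" where
  "grid_point m a = (\<chi> i. real (a i) / real m)"

lemma inj_grid_point: "m \<ge> 1 \<Longrightarrow> inj (grid_point m :: ('n::finite \<Rightarrow> nat) \<Rightarrow> real ^ 'n)"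
  by (auto simp: inj_def grid_point_def vec_eq_iff fun_eq_iff)

lemma grid_point_mem_grid_cell: "grid_point m a \<in> grid_cell m a"
  by (auto simp: mem_grid_cell grid_point_def divide_right_mono)

lemma measure_grid_cell:
  fixes a :: "'n::finite \<Rightarrow> nat"
  assumes "m \<ge> 1"
  shows "measure lborel (grid_cell m a) = 1 / real m ^ CARD('n)"
proof -
  have "grid_cell m a \<noteq> {}" using grid_point_mem_grid_cell by blast
  then show ?thesis
    unfolding grid_cell_def
    by (subst content_cbox_cart) (auto simp: diff_divide_distrib[symmetric] power_one_over)
qed

lemma grid_cell_subset:
  assumes "a \<in> grid m" "m \<ge> 1"
  shows "grid_cell m a \<subseteq> cbox 0 1"
proof
  fix x assume x: "x \<in> grid_cell m a"
  have "0 \<le> x $ i \<and> x $ i \<le> 1" for i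
  proof -
    have "(real (a i) - 1) / real m \<le> x $ i" "x $ i \<le> real (a i) / real m"
      using x by (auto simp: mem_grid_cell)
    moreover have "1 \<le> a i" "a i \<le> m" using assms by (auto simp: Pi_iff)
    then have "0 \<le> (real (a i) - 1) / real m" "real (a i) / real m \<le> 1"
      using assms(2) by auto
    ultimately show ?thesis by linarith
  qed
  then show "x \<in> cbox 0 1" by (simp add: mem_box_cart)
qed

lemma grid_cell_cover:
  assumes x: "x \<in> cbox 0 1" and m: "m \<ge> 1"
  shows "\<exists>a\<in>grid m. x \<in> grid_cell m a"
proof
  \<comment> \<open>The ceiling picks the cell with x below its upper corner; the maximum with 1
    repairs coordinates equal to 0, whose ceiling is not an index.\<close>
  define a where "a i = max 1 (nat \<lceil>real m * x $ i\<rceil>)" for i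
  have x01: "0 \<le> x $ i" "x $ i \<le> 1" for i using x by (auto simp: mem_box_cart)
  have "real m * x $ i \<le> real m" for i using x01[of i] by (simp add: mult_left_le)
  then have "nat \<lceil>real m * x $ i\<rceil> \<le> m" for i
    by (simp add: ceiling_le_iff nat_le_iff)
  then show "a \<in> grid m" using m by (auto simp: a_def)
  have "real (a i) - 1 \<le> real m * x $ i \<and> real m * x $ i \<le> real (a i)" for i
  proof -
    have "0 \<le> real m * x $ i" using x01 by simp
    then show ?thesis unfolding a_def by linarith
  qed
  then show "x \<in> grid_cell m a" using m by (simp add: mem_grid_cell field_simps)
qed

lemma dist_grid_cell_le:
  fixes x y :: "real ^ 'n"
  assumes "x \<in> grid_cell m a" "y \<in> grid_cell m a" "m \<ge> 1"
  shows "dist x y \<le> real CARD('n) / real m"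
proof -
  have "dist x y \<le> (\<Sum>i\<in>UNIV. \<bar>(x - y) $ i\<bar>)"
    unfolding dist_norm by (rule norm_le_l1_cart)
  also have "\<dots> \<le> (\<Sum>i\<in>(UNIV::'n set). 1 / real m)"
  proof (rule sum_mono)
    fix i
    have "(real (a i) - 1) / real m \<le> x $ i" "x $ i \<le> real (a i) / real m"
       "(real (a i) - 1) / real m \<le> y $ i" "y $ i \<le> real (a i) / real m"
      using assms by (auto simp: mem_grid_cell)
    then show "\<bar>(x - y) $ i\<bar> \<le> 1 / real m"
      by (auto simp: diff_divide_distrib abs_le_iff)
  qed
  finally show ?thesis by simp
qed

lemma grid_tagged_division:
  fixes \<tau> :: "('n::finite \<Rightarrow> nat) \<Rightarrow> real ^ 'n"
  assumes m: "m \<ge> 1" and \<tau>: "\<And>a. a \<in> grid m \<Longrightarrow> \<tau> a \<in> grid_cell m a"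
  shows "(\<lambda>a. (\<tau> a, grid_cell m a)) ` grid m tagged_division_of cbox 0 1"
  unfolding tagged_division_of
proof (intro conjI allI impI)
  show "finite ((\<lambda>a. (\<tau> a, grid_cell m a)) ` grid m)"
    by (intro finite_imageI finite_Pi_UNIV) simp
  fix x K assume "(x, K) \<in> (\<lambda>a. (\<tau> a, grid_cell m a)) ` grid m"
  then obtain a where a: "a \<in> grid m" "x = \<tau> a" "K = grid_cell m a" by auto
  show "x \<in> K" using a \<tau> by simp
  show "\<exists>a b. K = cbox a b" unfolding a(3) grid_cell_def by blast
  show "K \<subseteq> cbox 0 1" using a grid_cell_subset m by metis
next
  fix x1 K1 x2 K2
  assume "(x1, K1) \<in> (\<lambda>a. (\<tau> a, grid_cell m a)) ` grid m \<and>
    (x2, K2) \<in> (\<lambda>a. (\<tau> a, grid_cell m a)) ` grid m \<and> (x1, K1) \<noteq> (x2, K2)"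
  then obtain a b where ab: "K1 = grid_cell m a" "K2 = grid_cell m b" "a \<noteq> b" by auto
  then obtain i where i: "a i \<noteq> b i" by auto
  show "interior K1 \<inter> interior K2 = {}"
  proof (rule ccontr)
    assume "interior K1 \<inter> interior K2 \<noteq> {}"
    then obtain x where "x \<in> interior K1" "x \<in> interior K2" by blast
    then have "(real (a i) - 1) / real m < x $ i" "x $ i < real (a i) / real m"
      "(real (b i) - 1) / real m < x $ i" "x $ i < real (b i) / real m"
      unfolding ab grid_cell_def by (auto simp: mem_box_cart)
    then have "real (a i) - 1 < x $ i * real m" "x $ i * real m < real (a i)"
      "real (b i) - 1 < x $ i * real m" "x $ i * real m < real (b i)"
      using m by (auto simp: field_simps)
    with i show False by linarith
  qed
next
  show "\<Union> {K. \<exists>x. (x, K) \<in> (\<lambda>a. (\<tau> a, grid_cell m a)) ` grid m} = cbox 0 1"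
    (is "?U = _")
  proof
    show "?U \<subseteq> cbox 0 1" using grid_cell_subset[OF _ m] by fast
    show "cbox 0 1 \<subseteq> ?U" using grid_cell_cover[OF _ m] by blast
  qed
qed

lemma inj_grid_cell:
  assumes "m \<ge> 1"
  shows "inj (grid_cell m :: ('n::finite \<Rightarrow> nat) \<Rightarrow> (real ^ 'n) set)"
proof (rule injI)
  fix a b :: "'n::finite \<Rightarrow> nat" assume "grid_cell m a = grid_cell m b"
  moreover have "grid_cell m a \<noteq> {}" using grid_point_mem_grid_cell by blast
  ultimately have "(\<chi> i. real (a i) / real m) = (\<chi> i. real (b i) / real m)"
    unfolding grid_cell_def eq_cbox by blast
  then show "a = b" using assms by (auto simp: vec_eq_iff fun_eq_iff)
qed

text \<open>Cells have diameter at most n/m, so a constant radius admits every grid with m > n /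
  \<open>\<delta>\<close>; a variable gauge would give no such threshold. The tags stay free:
  corners produce the lattice sums, and moving a single tag yields boundedness.\<close>

lemma riemann_sum_grid:
  fixes h :: "real ^ 'n \<Rightarrow> 'b::real_normed_vector"
  assumes h: "has_riemann_integral_cbox h I 0 1" and "e > 0"
  shows "\<exists>m0\<ge>1. \<forall>m\<ge>m0. \<forall>\<tau>. (\<forall>a\<in>grid m. \<tau> a \<in> grid_cell m a) \<longrightarrow>
    norm ((\<Sum>a\<in>grid m. h (\<tau> a)) /\<^sub>R real m ^ CARD('n) - I) < e"
proof -
  obtain \<delta> where \<delta>: "\<delta> > 0" and
    dI: "\<And>p. p tagged_division_of cbox 0 1 \<Longrightarrow> (\<lambda>x. ball x \<delta>) fine p \<Longrightarrow>
       norm ((\<Sum>(x,K)\<in>p. measure lborel K *\<^sub>R h x) - I) < e"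
    using h[unfolded has_riemann_integral_cbox_def, rule_format, OF \<open>e > 0\<close>] by blast
  obtain m1 where m1: "real CARD('n) / \<delta> < real m1" using reals_Archimedean2 by blast
  show ?thesis
  proof (intro exI[of _ "Suc m1"] conjI allI impI)
    fix m and \<tau> :: "('n \<Rightarrow> nat) \<Rightarrow> real ^ 'n"
    assume "Suc m1 \<le> m" and \<tau>: "\<forall>a\<in>grid m. \<tau> a \<in> grid_cell m a"
    then have m: "m \<ge> 1" "real CARD('n) / \<delta> < real m" using m1 by auto
    define p where "p = (\<lambda>a. (\<tau> a, grid_cell m a)) ` grid m"
    have "(\<lambda>x. ball x \<delta>) fine p"
    proof (rule fineI)
      fix x K assume "(x, K) \<in> p"
      then obtain a where a: "a \<in> grid m" "x = \<tau> a" "K = grid_cell m a" unfolding p_def by auto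
      have "real CARD('n) / real m < \<delta>" using m \<delta> by (simp add: field_simps)
      then show "K \<subseteq> ball x \<delta>"
        using dist_grid_cell_le[of x m a] a \<tau> m(1) by (fastforce intro: le_less_trans)
    qed
    moreover have "p tagged_division_of cbox 0 1"
      unfolding p_def using \<tau> m by (intro grid_tagged_division) auto
    moreover have "(\<Sum>(x,K)\<in>p. measure lborel K *\<^sub>R h x) =
        (\<Sum>a\<in>grid m. h (\<tau> a)) /\<^sub>R real m ^ CARD('n)"
    proof -
      have "inj_on (\<lambda>a. (\<tau> a, grid_cell m a)) (grid m)"
        using inj_grid_cell[OF m(1)] by (auto simp: inj_on_def)
      then show ?thesis
        unfolding p_def
        by (simp add: sum.reindex measure_grid_cell[OF m(1)] scaleR_right.sum inverse_eq_divide)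
    qed
    ultimately show "norm ((\<Sum>a\<in>grid m. h (\<tau> a)) /\<^sub>R real m ^ CARD('n) - I) < e"
      using dI[of p] by simp
  qed simp
qed

text \<open>Moving a single tag changes a fine Riemann sum by less than \<open>2\<close>, so the oscillation of
  the integrand on each cell of a fixed grid is finite.\<close>

lemma has_riemann_integral_cbox_bounded:
  fixes h :: "real ^ 'n \<Rightarrow> 'b::real_normed_vector"
  assumes h: "has_riemann_integral_cbox h I 0 1"
  shows "\<exists>M. \<forall>x\<in>cbox 0 1. norm (h x) \<le> M"
proof -
  obtain m where m: "m \<ge> 1" and
    S: "\<And>\<tau>. (\<forall>a\<in>grid m. \<tau> a \<in> grid_cell m a) \<Longrightarrow>
      norm ((\<Sum>a\<in>grid m. h (\<tau> a)) /\<^sub>R real m ^ CARD('n) - I) < 1"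
    using riemann_sum_grid[OF h, of 1] by auto
  \<comment> \<open>Each cell has weight 1/m^n, so a change of the Riemann sum by less than 2 means
    a change of \<open>h\<close> by less than 2 m^n. The second summand dominates the value at every
    corner.\<close>
  define M where "M = 2 * real m ^ CARD('n) + (\<Sum>a\<in>grid m. norm (h (grid_point m a)))"
  have fin: "finite (grid m :: ('n \<Rightarrow> nat) set)" by (intro finite_Pi_UNIV) simp
  have "norm (h x) \<le> M" if x: "x \<in> cbox 0 1" for x
  proof -
    obtain a where a: "a \<in> grid m" "x \<in> grid_cell m a"
      using grid_cell_cover[OF x m] by blast
    define R where "R \<tau> = (\<Sum>a\<in>grid m. h (\<tau> a)) /\<^sub>R real m ^ CARD('n)"
      for \<tau> :: "('n \<Rightarrow> nat) \<Rightarrow> real ^ 'n"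
    have R: "norm (R \<tau> - I) < 1" if "\<forall>a\<in>grid m. \<tau> a \<in> grid_cell m a" for \<tau>
      unfolding R_def using S[OF that] .
    have "norm (R ((grid_point m)(a := x)) - I) < 1" "norm (R (grid_point m) - I) < 1"
      by (rule R; simp add: a grid_point_mem_grid_cell)+
    then have "norm (R ((grid_point m)(a := x)) - R (grid_point m)) < 2"
      using norm_triangle_ineq4[of "R ((grid_point m)(a := x)) - I" "R (grid_point m) - I"] by simp
    moreover have "R ((grid_point m)(a := x)) - R (grid_point m) = (h x - h (grid_point m a)) /\<^sub>R real m ^ CARD('n)"
    proof -
      have "(\<Sum>b\<in>grid m. h (((grid_point m)(a := x)) b)) = h x + (\<Sum>b\<in>grid m - {a}. h (grid_point m b))"
        using fin a(1) by (subst sum.remove[of _ a]) auto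
      moreover have "(\<Sum>b\<in>grid m. h (grid_point m b)) = h (grid_point m a) + (\<Sum>b\<in>grid m - {a}. h (grid_point m b))"
        using fin a(1) by (subst sum.remove[of _ a]) auto
      ultimately show ?thesis by (simp add: R_def scaleR_diff_right[symmetric])
    qed
    ultimately have "norm ((h x - h (grid_point m a)) /\<^sub>R real m ^ CARD('n)) < 2" by (simp only:)
    then have "norm (h x - h (grid_point m a)) / real m ^ CARD('n) < 2"
      by (simp only: norm_scaleR) (simp add: divide_inverse mult.commute)
    then have "norm (h x - h (grid_point m a)) < 2 * real m ^ CARD('n)"
      using m by (simp add: divide_less_eq)
    moreover have "norm (h (grid_point m a)) \<le> (\<Sum>a\<in>grid m. norm (h (grid_point m a)))"
      using fin a(1) by (intro member_le_sum) auto
    ultimately show ?thesis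
      unfolding M_def using norm_triangle_sub[of "h x" "h (grid_point m a)"] by linarith
  qed
  then show ?thesis by blast
qed

section \<open>Points with a given denominator\<close>

definition lattice_points :: "(real ^ 'n) set \<Rightarrow> nat \<Rightarrow> (real ^ 'n) set" where
  "lattice_points X m = {x \<in> X. \<forall>i. real m * x $ i \<in> \<int>}"

definition den_points :: "(real ^ 'n) set \<Rightarrow> nat \<Rightarrow> (real ^ 'n) set" where
  "den_points X k = {x \<in> X \<inter> rational_points. den x = k}"

lemma den_ge_1: "x \<in> rational_points \<Longrightarrow> 1 \<le> den x"
  using is_den_den[of x] by (simp add: is_den_def)

text \<open>If m x is integral, then k = \<open>den x\<close> divides m k and all m a_i, hence their
  gcd, which is m because the a_i and k together have gcd 1.\<close>

lemma den_dvd_iff: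
  assumes "x \<in> rational_points"
  shows "den x dvd m \<longleftrightarrow> (\<forall>i. real m * x $ i \<in> \<int>)"
proof -
  obtain a where k: "den x \<ge> 1" and a: "\<And>i. x $ i = real_of_int (a i) / real (den x)"
    and G: "Gcd (insert (int (den x)) (range a)) = 1"
    using is_den_den[OF assms] unfolding is_den_def by blast
  show ?thesis
  proof
    assume "den x dvd m"
    then obtain c where "m = den x * c" by blast
    then have "real m * x $ i = of_int (int c * a i)" for i
      using k by (simp add: a[of i])
    then show "\<forall>i. real m * x $ i \<in> \<int>" by (metis Ints_of_int)
  next
    assume "\<forall>i. real m * x $ i \<in> \<int>"
    then have "\<forall>i. \<exists>b. real m * x $ i = of_int b" by (metis Ints_cases)
    then obtain b where b: "\<And>i. real m * x $ i = of_int (b i)" by metis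
    have "int m * a i = int (den x) * b i" for i
    proof -
      have "real_of_int (int m * a i) = real_of_int (int (den x) * b i)"
        using k b[of i] by (simp add: a[of i] field_simps)
      then show ?thesis by (simp only: of_int_eq_iff)
    qed
    then have "int (den x) dvd Gcd ((*) (int m) ` insert (int (den x)) (range a))"
      by (intro Gcd_greatest) auto
    also have "\<dots> = int m" by (simp only: Gcd_mult G) simp
    finally show "den x dvd m" by simp
  qed
qed

lemma lattice_points_eq_UN:
  assumes "m \<ge> 1"
  shows "lattice_points X m = (\<Union>d\<in>{d. d dvd m}. den_points X d)"
proof -
  have "x \<in> rational_points" if "\<forall>i. real m * x $ i \<in> \<int>" for x :: "real ^ 'a"
  proof -
    have "x $ i \<in> \<rat>" for i
    proof -
      have "(real m * x $ i) / real m \<in> \<rat>"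
        using that Ints_subset_Rats by (intro Rats_divide Rats_of_nat) blast
      then show ?thesis using assms by simp
    qed
    then show ?thesis by (simp add: rational_points_def)
  qed
  then show ?thesis
    by (auto simp: lattice_points_def den_points_def den_dvd_iff)
qed

lemma den_points_subset_lattice_points: "k \<ge> 1 \<Longrightarrow> den_points X k \<subseteq> lattice_points X k"
  using UN_upper[of k "{d. d dvd k}" "den_points X"] by (simp add: lattice_points_eq_UN)

lemma lattice_points_closed_cube:
  assumes "m \<ge> 1" "x \<in> lattice_points closed_cube m"
  shows "\<exists>a. x = grid_point m a \<and> (\<forall>i. a i \<le> m)"
proof -
  have x: "0 \<le> x $ i" "x $ i \<le> 1" "real m * x $ i \<in> \<int>" for i
    using assms(2) by (auto simp: lattice_points_def closed_cube_def)
  define a where "a i = nat \<lfloor>real m * x $ i\<rfloor>" for i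
  have a: "real (a i) = real m * x $ i" for i
    using x[of i] by (simp add: a_def)
  have "real (a i) \<le> real m" for i
    unfolding a using x[of i] by (simp add: mult_left_le)
  then have "a i \<le> m" for i by (simp only: of_nat_le_iff)
  then show ?thesis
    using assms(1) by (intro exI[of _ a]) (simp add: grid_point_def vec_eq_iff a)
qed

lemma half_open_subset_closed: "half_open_cube \<subseteq> closed_cube"
  by (auto simp: half_open_cube_def closed_cube_def intro: less_imp_le)

lemma closed_cube_eq_cbox: "closed_cube = cbox 0 1"
  by (auto simp: closed_cube_def mem_box_cart)

lemma lattice_points_half_open_cube:
  assumes "m \<ge> 1"
  shows "lattice_points (half_open_cube :: (real ^ 'n) set) m = grid_point m ` grid m"
proof
  show "lattice_points (half_open_cube :: (real ^ 'n) set) m \<subseteq> grid_point m ` grid m"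
  proof
    fix x :: "real ^ 'n" assume x: "x \<in> lattice_points half_open_cube m"
    then have "x \<in> lattice_points closed_cube m"
      using half_open_subset_closed by (auto simp: lattice_points_def)
    then obtain a where a: "x = grid_point m a" "\<And>i. a i \<le> m"
      using lattice_points_closed_cube assms by blast
    have "0 < x $ i" for i using x by (auto simp: lattice_points_def half_open_cube_def)
    then have "a i \<noteq> 0" for i using a(1) by (auto simp: grid_point_def zero_less_divide_iff)
    then show "x \<in> grid_point m ` grid m" using a by (auto simp: Suc_le_eq)
  qed
  show "grid_point m ` grid m \<subseteq> lattice_points (half_open_cube :: (real ^ 'n) set) m"
  proof
    fix x :: "real ^ 'n" assume "x \<in> grid_point m ` grid m"
    then obtain a where a: "x = grid_point m a" "\<And>i. 1 \<le> a i \<and> a i \<le> m" by (auto simp: Pi_iff)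
    have "0 < x $ i \<and> x $ i \<le> 1 \<and> real m * x $ i \<in> \<int>" for i
      using a(2)[of i] assms by (simp add: a(1) grid_point_def)
    then show "x \<in> lattice_points half_open_cube m"
      by (simp add: lattice_points_def half_open_cube_def)
  qed
qed

lemma card_lattice_points_half_open_cube:
  assumes "m \<ge> 1"
  shows "card (lattice_points (half_open_cube :: (real ^ 'n) set) m) = m ^ CARD('n)"
  using assms
  by (simp add: lattice_points_half_open_cube card_Pi_UNIV
      card_image[OF inj_on_subset[OF inj_grid_point[OF assms] subset_UNIV]])

lemma finite_lattice_points:
  assumes "m \<ge> 1" "X \<subseteq> closed_cube"
  shows "finite (lattice_points X m)"
    and "card (lattice_points (X :: (real ^ 'n) set) m) \<le> (m + 1) ^ CARD('n)"
proof -
  have sub: "lattice_points X m \<subseteq> grid_point m ` Pi UNIV (\<lambda>_. {0..m})"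
  proof
    fix x assume "x \<in> lattice_points X m"
    then have "x \<in> lattice_points closed_cube m"
      using assms(2) by (auto simp: lattice_points_def)
    then show "x \<in> grid_point m ` Pi UNIV (\<lambda>_. {0..m})"
      using lattice_points_closed_cube[OF assms(1)] by fastforce
  qed
  have fin: "finite (Pi (UNIV :: 'n set) (\<lambda>_. {0..m}))" by (rule finite_Pi_UNIV) simp
  show "finite (lattice_points X m)"
    using sub fin by (meson finite_imageI finite_subset)
  have "card (lattice_points X m) \<le> card (Pi (UNIV :: 'n set) (\<lambda>_. {0..m}))"
    using sub fin by (rule surj_card_le[rotated])
  then show "card (lattice_points X m) \<le> (m + 1) ^ CARD('n)"
    by (simp add: card_Pi_UNIV)
qed

section \<open>Lattice sums of a Riemann-integrable function\<close>

lemma closure_cube: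
  assumes "half_open_cube \<subseteq> X" "X \<subseteq> closed_cube"
  shows "closure X = cbox (0 :: real ^ 'n) 1"
proof
  show "closure X \<subseteq> cbox 0 1"
    using assms(2) by (simp add: closed_cube_eq_cbox closure_minimal closed_cbox)
  have "box 0 1 \<subseteq> X"
    using assms(1) by (auto simp: half_open_cube_def mem_box_cart subset_iff less_imp_le)
  moreover have "box (0 :: real ^ 'n) 1 \<noteq> {}" by (simp add: interval_ne_empty_cart)
  ultimately show "cbox 0 1 \<subseteq> closure X"
    using closure_mono closure_box by metis
qed

lemma riemann_integral_cube:
  fixes f :: "real ^ 'n \<Rightarrow> 'b::real_normed_vector"
  assumes f: "has_riemann_integral f I X" and X: "half_open_cube \<subseteq> X" "X \<subseteq> closed_cube"
  shows "has_riemann_integral_cbox (\<lambda>x. if x \<in> X then f x else 0) I 0 1"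
    and "\<exists>M\<ge>0. \<forall>x\<in>X. norm (f x) \<le> M"
proof -
  show 1: "has_riemann_integral_cbox (\<lambda>x. if x \<in> X then f x else 0) I 0 1"
    by (rule has_riemann_integral_imp_cbox[OF f closure_cube[OF X]]) (simp add: interval_ne_empty_cart)
  obtain M where "\<forall>x\<in>cbox 0 1. norm (if x \<in> X then f x else 0) \<le> M"
    using has_riemann_integral_cbox_bounded[OF 1] by blast
  then have "\<forall>x\<in>X. norm (f x) \<le> max M 0"
    using X(2) unfolding closed_cube_eq_cbox by (fastforce simp: le_max_iff_disj)
  then show "\<exists>M\<ge>0. \<forall>x\<in>X. norm (f x) \<le> M" by (intro exI[of _ "max M 0"]) auto
qed

text \<open>Over the half-open cube the lattice sum is m^n times a Riemann sum tagged at upper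
  corners. The other lattice points of X have a zero coordinate; there are at most (m+1)^n - m^n =
  o(m^n) of them, and f is bounded.\<close>

lemma lattice_sum_tendsto:
  fixes f :: "real ^ 'n \<Rightarrow> 'b::real_normed_vector"
  assumes f: "has_riemann_integral f I X" and X: "half_open_cube \<subseteq> X" "X \<subseteq> closed_cube"
  shows "(\<lambda>m. norm (\<Sum>x\<in>lattice_points X m. f x - I) / real m ^ CARD('n)) \<longlonglongrightarrow> 0"
proof -
  define h where "h = (\<lambda>x. if x \<in> X then f x else 0)"
  have h: "has_riemann_integral_cbox h I 0 1"
    using riemann_integral_cube(1)[OF assms] by (simp add: h_def)
  obtain M where M: "M \<ge> 0" "\<And>x. x \<in> X \<Longrightarrow> norm (f x) \<le> M"
    using riemann_integral_cube(2)[OF assms] by blast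
  define R where "R m = (\<Sum>a\<in>grid m. h (grid_point m a)) /\<^sub>R real m ^ CARD('n)" for m
  have R: "(\<lambda>m. norm (R m - I)) \<longlonglongrightarrow> 0"
  proof (rule LIMSEQ_I)
    fix e :: real assume "e > 0"
    then obtain m0 where "\<forall>m\<ge>m0. \<forall>\<tau>. (\<forall>a\<in>grid m. \<tau> a \<in> grid_cell m a) \<longrightarrow>
        norm ((\<Sum>a\<in>grid m. h (\<tau> a)) /\<^sub>R real m ^ CARD('n) - I) < e"
      using riemann_sum_grid[OF h] by blast
    then have "\<forall>m\<ge>m0. norm (R m - I) < e"
      unfolding R_def using grid_point_mem_grid_cell by blast
    then show "\<exists>m0. \<forall>m\<ge>m0. norm (norm (R m - I) - 0) < e" by auto
  qed
  \<comment> \<open>The excess count (m+1)^n - m^n divided by m^n.\<close>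
  define E where "E m = (1 + 1 / real m) ^ CARD('n) - 1" for m
  have E: "E \<longlonglongrightarrow> 0"
  proof -
    have "(\<lambda>m. (1 + 1 / real m) ^ CARD('n) - 1) \<longlonglongrightarrow> (1 + 0) ^ CARD('n) - 1"
      by (intro tendsto_intros lim_1_over_n)
    then show ?thesis by (simp add: E_def[abs_def])
  qed
  have bound: "norm (\<Sum>x\<in>lattice_points X m. f x - I) / real m ^ CARD('n)
      \<le> norm (R m - I) + (M + norm I) * E m" if m: "m \<ge> 1" for m
  proof -
    define L where "L = lattice_points (half_open_cube :: (real ^ 'n) set) m"
    have L: "L \<subseteq> lattice_points X m" "L \<subseteq> X"
      using X(1) unfolding L_def by (auto simp: lattice_points_def)
    note fin = finite_lattice_points[OF m X(2)]
    have finL: "finite L" using L(1) fin(1) by (rule finite_subset)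
    have cL: "card L = m ^ CARD('n)"
      unfolding L_def by (rule card_lattice_points_half_open_cube[OF m])
    have "(\<Sum>x\<in>L. f x) = (\<Sum>a\<in>grid m. h (grid_point m a))"
    proof -
      have "(\<Sum>x\<in>L. f x) = (\<Sum>x\<in>L. h x)"
        using L(2) by (intro sum.cong) (auto simp: h_def)
      also have "\<dots> = (\<Sum>a\<in>grid m. h (grid_point m a))"
        unfolding L_def lattice_points_half_open_cube[OF m]
        by (simp add: sum.reindex[OF inj_on_subset[OF inj_grid_point[OF m] subset_UNIV]])
      finally show ?thesis .
    qed
    then have "(\<Sum>x\<in>L. f x - I) = real m ^ CARD('n) *\<^sub>R (R m - I)"
      using m by (simp add: sum_subtractf R_def cL scaleR_diff_right sum_constant_scaleR)
    then have 1: "norm (\<Sum>x\<in>L. f x - I) = real m ^ CARD('n) * norm (R m - I)" by simp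
    have "norm (\<Sum>x\<in>lattice_points X m - L. f x - I)
        \<le> real (card (lattice_points X m - L)) * (M + norm I)"
    proof (rule sum_norm_bound)
      fix x assume "x \<in> lattice_points X m - L"
      then show "norm (f x - I) \<le> M + norm I"
        using norm_triangle_ineq4[of "f x" I] M(2)[of x] by (auto simp: lattice_points_def)
    qed
    also have "\<dots> \<le> (real m ^ CARD('n) * E m) * (M + norm I)"
    proof (rule mult_right_mono)
      have "real (card (lattice_points X m - L)) = real (card (lattice_points X m)) - real m ^ CARD('n)"
        using L(1) finL fin(1) card_mono[OF fin(1) L(1)] cL by (simp add: card_Diff_subset of_nat_diff)
      also have "real (card (lattice_points X m)) \<le> real ((m + 1) ^ CARD('n))"
        using fin(2) by (simp only: of_nat_le_iff)
      also have "real ((m + 1) ^ CARD('n)) = (real m * (1 + 1 / real m)) ^ CARD('n)"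
      proof -
        have "real (m + 1) = real m * (1 + 1 / real m)" using m by (simp add: field_simps)
        then show ?thesis by (simp only: of_nat_power)
      qed
      finally show "real (card (lattice_points X m - L)) \<le> real m ^ CARD('n) * E m"
        by (simp only: E_def power_mult_distrib right_diff_distrib mult_1_right)
    qed (use M in simp)
    finally have 2: "norm (\<Sum>x\<in>lattice_points X m - L. f x - I)
        \<le> real m ^ CARD('n) * ((M + norm I) * E m)" by (simp add: mult_ac)
    have "(\<Sum>x\<in>lattice_points X m. f x - I) =
        (\<Sum>x\<in>lattice_points X m - L. f x - I) + (\<Sum>x\<in>L. f x - I)"
      using L(1) fin(1) by (rule sum.subset_diff)
    then have "norm (\<Sum>x\<in>lattice_points X m. f x - I)
        \<le> real m ^ CARD('n) * (norm (R m - I) + (M + norm I) * E m)"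
      using 1 2 norm_triangle_ineq[of "\<Sum>x\<in>lattice_points X m - L. f x - I" "\<Sum>x\<in>L. f x - I"]
      by (simp add: distrib_left)
    then show ?thesis using m by (simp add: divide_le_eq mult.commute)
  qed
  have "(\<lambda>m. norm (R m - I) + (M + norm I) * E m) \<longlonglongrightarrow> 0 + (M + norm I) * 0"
    by (intro tendsto_intros R E)
  then have lim: "(\<lambda>m. norm (R m - I) + (M + norm I) * E m) \<longlonglongrightarrow> 0" by simp
  show ?thesis
    by (rule tendsto_sandwich[OF _ _ tendsto_const lim])
      (use bound in \<open>auto intro!: eventually_sequentiallyI[of 1]\<close>)
qed

text \<open>Past some m0, at most N terms remain and each is at most (e/2) N^n; the first m0 terms
  contribute a constant. This carries o(m^n) for lattice sums over to o(N^(n+1)) for their sum over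
  m.\<close>

lemma cesaro_power_tendsto_0:
  fixes t :: "nat \<Rightarrow> real"
  assumes nonneg: "\<And>m. 0 \<le> t m" and t: "(\<lambda>m. t m / real m ^ n) \<longlonglongrightarrow> 0"
  shows "(\<lambda>N. (\<Sum>m=1..N. t m) / real N ^ Suc n) \<longlonglongrightarrow> 0"
proof (rule order_tendstoI)
  fix e :: real assume e: "0 < e"
  have "\<forall>\<^sub>F m in sequentially. t m / real m ^ n < e / 2"
    using t e by (intro order_tendstoD(2)) auto
  then obtain m0 where m0: "\<And>m. m \<ge> m0 \<Longrightarrow> t m / real m ^ n < e / 2"
    unfolding eventually_sequentially by blast
  define C where "C = (\<Sum>m=1..m0. t m)"
  have C: "C \<ge> 0" unfolding C_def by (intro sum_nonneg nonneg)
  have bound: "(\<Sum>m=1..N. t m) \<le> C + e / 2 * real N ^ Suc n" for N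
  proof -
    have "(\<Sum>m=1..N. t m) \<le> (\<Sum>m\<in>{1..m0} \<union> {m0<..N}. t m)"
      by (intro sum_mono2) (auto simp: nonneg)
    also have "\<dots> = C + (\<Sum>m\<in>{m0<..N}. t m)"
      unfolding C_def by (intro sum.union_disjoint) auto
    also have "(\<Sum>m\<in>{m0<..N}. t m) \<le> real (card {m0<..N}) * (e / 2 * real N ^ n)"
    proof (rule sum_bounded_above)
      fix m assume m: "m \<in> {m0<..N}"
      then have "t m \<le> e / 2 * real m ^ n"
        using m0[of m] by (simp add: divide_less_eq)
      also have "\<dots> \<le> e / 2 * real N ^ n"
        using m e by (intro mult_left_mono power_mono) auto
      finally show "t m \<le> e / 2 * real N ^ n" .
    qed
    also have "\<dots> \<le> real N * (e / 2 * real N ^ n)"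
      using e by (intro mult_right_mono) auto
    finally show ?thesis by (simp add: mult_ac)
  qed
  obtain N1 where N1: "2 * C / e < real N1" using reals_Archimedean2 by blast
  show "\<forall>\<^sub>F N in sequentially. (\<Sum>m=1..N. t m) / real N ^ Suc n < e"
    unfolding eventually_sequentially
  proof (intro exI[of _ "Suc N1"] allI impI)
    fix N assume N: "Suc N1 \<le> N"
    have "C < e / 2 * real N1" using N1 e by (simp add: field_simps)
    also have "\<dots> \<le> e / 2 * real N ^ Suc n"
    proof (intro mult_left_mono)
      have "real N1 \<le> real N ^ 1" using N by simp
      also have "\<dots> \<le> real N ^ Suc n" using N by (intro power_increasing) auto
      finally show "real N1 \<le> real N ^ Suc n" .
    qed (use e in simp)
    finally have "(\<Sum>m=1..N. t m) < e * real N ^ Suc n" using bound[of N] by linarith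
    then show "(\<Sum>m=1..N. t m) / real N ^ Suc n < e"
      using N by (simp only: divide_less_eq) simp
  qed
next
  fix e :: real assume "e < 0"
  moreover have "0 \<le> (\<Sum>m=1..N. t m) / real N ^ Suc n" for N
    by (intro divide_nonneg_nonneg sum_nonneg nonneg) auto
  ultimately show "\<forall>\<^sub>F N in sequentially. e < (\<Sum>m=1..N. t m) / real N ^ Suc n"
    by (intro always_eventually allI) (rule less_le_trans)
qed

text \<open>Only the upper half of the range is kept: at least N/2 terms, each at least
  (N/2)^n.\<close>

lemma sum_power_ge: "(real N / 2) ^ Suc n \<le> (\<Sum>m=1..N. real m ^ n)"
proof -
  have "(real N / 2) ^ Suc n = (real N / 2) * (real N / 2) ^ n" by simp
  also have "\<dots> \<le> real (card {N div 2<..N}) * (real N / 2) ^ n"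
    by (intro mult_right_mono) (auto simp: of_nat_diff)
  also have "\<dots> \<le> (\<Sum>m\<in>{N div 2<..N}. real m ^ n)"
    by (intro sum_bounded_below power_mono) auto
  also have "\<dots> \<le> (\<Sum>m=1..N. real m ^ n)"
    by (intro sum_mono2) auto
  finally show ?thesis .
qed

lemma sum_lattice_points:
  fixes g :: "real ^ 'n \<Rightarrow> 'b::comm_monoid_add"
  assumes "m \<ge> 1" "X \<subseteq> closed_cube"
  shows "(\<Sum>x\<in>lattice_points X m. g x) = (\<Sum>d | d dvd m. \<Sum>x\<in>den_points X d. g x)"
proof -
  have fin: "finite (den_points X d)" if "d dvd m" for d
    using finite_subset[OF _ finite_lattice_points(1)[OF assms], of "den_points X d"] that
      lattice_points_eq_UN[OF assms(1), of X] by auto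
  show ?thesis
    unfolding lattice_points_eq_UN[OF assms(1)]
  proof (rule sum.UNION_disjoint)
    show "finite {d. d dvd m}" using assms(1) by (intro finite_divisors_nat) auto
    show "\<forall>d\<in>{d. d dvd m}. finite (den_points X d)" using fin by auto
    show "\<forall>d\<in>{d. d dvd m}. \<forall>d'\<in>{d. d dvd m}. d \<noteq> d' \<longrightarrow> den_points X d \<inter> den_points X d' = {}"
      by (auto simp: den_points_def)
  qed
qed

section \<open>Counting points of bounded denominator\<close>

lemma finite_den_points:
  assumes "k \<ge> 1" "X \<subseteq> closed_cube"
  shows "finite (den_points X k)"
    and "real (card (den_points (X :: (real ^ 'n) set) k)) \<le> (2 * real k) ^ CARD('n)"
proof -
  note L = finite_lattice_points[OF assms] and S = den_points_subset_lattice_points[OF assms(1), of X]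
  show "finite (den_points X k)" using S L(1) by (rule finite_subset)
  have "card (den_points X k) \<le> (k + 1) ^ CARD('n)"
    using card_mono[OF L(1) S] L(2) by linarith
  also have "\<dots> \<le> (2 * k) ^ CARD('n)" using assms(1) by (intro power_mono) auto
  finally have "real (card (den_points X k)) \<le> real ((2 * k) ^ CARD('n))" by (simp only: of_nat_le_iff)
  then show "real (card (den_points X k)) \<le> (2 * real k) ^ CARD('n)" by simp
qed

text \<open>For the half-open cube the summands are the values of Jordan's totient J_n, which for n
  = 1 is Euler's phi.\<close>

definition count_den_le :: "(real ^ 'n) set \<Rightarrow> nat \<Rightarrow> nat" where
  "count_den_le X N = (\<Sum>k=1..N. card (den_points X k))"

lemma sum_den_points_Un:
  fixes g :: "real ^ 'n \<Rightarrow> 'b::comm_monoid_add"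
  assumes "X \<subseteq> closed_cube"
  shows "(\<Sum>x\<in>(\<Union>k\<in>{1..N}. den_points X k). g x) = (\<Sum>k=1..N. \<Sum>x\<in>den_points X k. g x)"
  using finite_den_points(1)[OF _ assms]
  by (intro sum.UNION_disjoint) (auto simp: den_points_def)

lemma card_den_points_Un:
  assumes "X \<subseteq> closed_cube"
  shows "card (\<Union>k\<in>{1..N}. den_points X k) = count_den_le X N"
  using sum_den_points_Un[OF assms, of "\<lambda>_. 1 :: nat" N] by (simp add: count_den_le_def)

lemma count_den_le_le:
  assumes "X \<subseteq> closed_cube"
  shows "real (count_den_le (X :: (real ^ 'n) set) N) \<le> 2 ^ CARD('n) * real N ^ Suc CARD('n)"
proof -
  have "real (count_den_le X N) \<le> (\<Sum>k=1..N. (2 * real N) ^ CARD('n))"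
    unfolding count_den_le_def of_nat_sum
  proof (rule sum_mono)
    fix k assume k: "k \<in> {1..N}"
    then have "real (card (den_points X k)) \<le> (2 * real k) ^ CARD('n)"
      using assms by (intro finite_den_points) auto
    also have "\<dots> \<le> (2 * real N) ^ CARD('n)" using k by (intro power_mono) auto
    finally show "real (card (den_points X k)) \<le> (2 * real N) ^ CARD('n)" .
  qed
  then show ?thesis by (simp add: power_mult_distrib mult_ac)
qed

text \<open>This lower bound turns o(N^(n+1)) into "negligible against the number of points". Each m
  supplies at least m^n lattice points, and sum m^n >= (N/2)^(n+1) feeds the cut-off argument for
  monotone counts.\<close>

lemma count_den_le_ge:
  fixes X :: "(real ^ 'n) set"
  assumes X: "half_open_cube \<subseteq> X" "X \<subseteq> closed_cube"
  shows "\<exists>c>0. \<forall>N. c * real N ^ Suc CARD('n) \<le> real (count_den_le X N)"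
proof (rule hyperbola_lower_bound)
  show "2 \<le> Suc CARD('n)" by (simp add: Suc_le_eq)
  show "mono (\<lambda>N. real (count_den_le X N))"
    unfolding count_den_le_def by (auto intro!: monoI sum_mono2)
  show "real (count_den_le X N) \<le> 2 ^ CARD('n) * real N ^ Suc CARD('n)" for N
    by (rule count_den_le_le[OF X(2)])
  show "(1 / 2 :: real) ^ Suc CARD('n) > 0" by simp
  fix N
  have "(1 / 2) ^ Suc CARD('n) * real N ^ Suc CARD('n) = (real N / 2) ^ Suc CARD('n)"
    by (simp add: power_divide)
  also have "\<dots> \<le> (\<Sum>m=1..N. real m ^ CARD('n))" by (rule sum_power_ge)
  also have "\<dots> \<le> (\<Sum>m=1..N. real (\<Sum>d | d dvd m. card (den_points X d)))"
  proof (rule sum_mono)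
    fix m assume "m \<in> {1..N}"
    then have m: "m \<ge> 1" by simp
    have "m ^ CARD('n) = card (lattice_points (half_open_cube :: (real ^ 'n) set) m)"
      by (rule card_lattice_points_half_open_cube[OF m, symmetric])
    also have "\<dots> \<le> card (lattice_points X m)"
      using X(1) by (intro card_mono finite_lattice_points[OF m X(2)]) (auto simp: lattice_points_def)
    also have "\<dots> = (\<Sum>d | d dvd m. card (den_points X d))"
      using sum_lattice_points[OF m X(2), of "\<lambda>_. 1 :: nat"] by simp
    finally have "real (m ^ CARD('n)) \<le> real (\<Sum>d | d dvd m. card (den_points X d))"
      by (simp only: of_nat_le_iff)
    then show "real m ^ CARD('n) \<le> real (\<Sum>d | d dvd m. card (den_points X d))"
      by simp
  qed
  also have "\<dots> = real (\<Sum>m=1..N. \<Sum>d | d dvd m. card (den_points X d))" by simp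
  also have "\<dots> = (\<Sum>j=1..N. real (count_den_le X (N div j)))"
    by (simp only: sum_sum_divisors count_den_le_def of_nat_sum)
  finally show "(1 / 2) ^ Suc CARD('n) * real N ^ Suc CARD('n) \<le> \<dots>" .
qed simp

lemma sum_den_le_tendsto_0:
  fixes f :: "real ^ 'n \<Rightarrow> 'b::real_normed_vector"
  assumes f: "has_riemann_integral f I X" and X: "half_open_cube \<subseteq> X" "X \<subseteq> closed_cube"
  shows "(\<lambda>N. norm (\<Sum>k=1..N. \<Sum>x\<in>den_points X k. f x - I) / real N ^ Suc CARD('n)) \<longlonglongrightarrow> 0"
proof -
  define G where "G N = (\<Sum>m=1..N. \<Sum>d | d dvd m. \<Sum>x\<in>den_points X d. f x - I)" for N
  obtain M where M: "M \<ge> 0" "\<And>x. x \<in> X \<Longrightarrow> norm (f x) \<le> M"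
    using riemann_integral_cube(2)[OF assms] by blast
  have G: "G N = (\<Sum>j=1..N. \<Sum>k=1..N div j. \<Sum>x\<in>den_points X k. f x - I)" for N
    unfolding G_def by (rule sum_sum_divisors)
  \<comment> \<open>The a priori bound that starts the iteration: boundedness of f times the trivial
    count of points.\<close>
  have F: "norm (\<Sum>k=1..N. \<Sum>x\<in>den_points X k. f x - I)
      \<le> (M + norm I) * 2 ^ CARD('n) * real N ^ Suc CARD('n)" for N
  proof -
    have "norm (\<Sum>k=1..N. \<Sum>x\<in>den_points X k. f x - I)
        \<le> (\<Sum>k=1..N. real (card (den_points X k)) * (M + norm I))"
    proof (intro sum_norm_le sum_norm_bound)
      fix k x assume "x \<in> den_points X k"
      then show "norm (f x - I) \<le> M + norm I"
        using norm_triangle_ineq4[of "f x" I] M(2)[of x] by (auto simp: den_points_def)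
    qed
    also have "\<dots> = real (count_den_le X N) * (M + norm I)"
      by (simp only: count_den_le_def of_nat_sum sum_distrib_right)
    also have "\<dots> \<le> (2 ^ CARD('n) * real N ^ Suc CARD('n)) * (M + norm I)"
      using M(1) by (intro mult_right_mono count_den_le_le X) auto
    finally show ?thesis by (simp only: mult_ac)
  qed
  define t where "t m = norm (\<Sum>x\<in>lattice_points X m. f x - I)" for m
  have lim: "(\<lambda>N. (\<Sum>m=1..N. t m) / real N ^ Suc CARD('n)) \<longlonglongrightarrow> 0"
    by (rule cesaro_power_tendsto_0) (use lattice_sum_tendsto[OF assms] in \<open>auto simp: t_def\<close>)
  have "norm (G N) \<le> (\<Sum>m=1..N. t m)" for N
    unfolding G_def t_def by (intro sum_norm_le) (simp add: sum_lattice_points[OF _ X(2)])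
  then have G_lim: "(\<lambda>N. norm (G N) / real N ^ Suc CARD('n)) \<longlonglongrightarrow> 0"
    by (intro tendsto_sandwich[OF _ _ tendsto_const lim])
      (auto intro!: always_eventually divide_right_mono)
  show ?thesis
    by (rule hyperbola_inversion_tendsto_0[OF _ G F G_lim]) (simp add: Suc_le_eq)
qed

section \<open>Enumerations ordered by denominator\<close>

text \<open>With k = \<open>den (u s)\<close>, the set of the first s points lies between
  \<open>W (k - 1)\<close> and \<open>W k\<close>. The lower inclusion makes s at least a constant
  times k^(n+1); the upper one leaves only points of denominator k to subtract from
  \<open>F k\<close>. Both errors, o(k^(n+1)) and O(k^n), are small against s.\<close>

lemma uniformly_distributed_den_enumeration:
  fixes X :: "(real ^ 'n) set" and u :: "nat \<Rightarrow> real ^ 'n"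
  assumes X: "half_open_cube \<subseteq> X" "X \<subseteq> closed_cube"
    and u: "bij_betw u {1..} (X \<inter> rational_points)"
    and mono: "\<And>r s. 1 \<le> r \<Longrightarrow> r \<le> s \<Longrightarrow> den (u r) \<le> den (u s)"
  shows "uniformly_distributed u X"
  unfolding uniformly_distributed_def
proof (intro conjI allI impI)
  have uX: "u r \<in> X \<inter> rational_points" if "r \<ge> 1" for r
    using u that by (auto simp: bij_betw_def)
  show "u r \<in> X" if "1 \<le> r" for r using uX[OF that] by simp
  fix f :: "real ^ 'n \<Rightarrow> complex" assume "f riemann_integrable_on X"
  then obtain I where I: "has_riemann_integral f I X" unfolding riemann_integrable_on_def by blast
  then have int: "integral X f = I"
    by (intro integral_unique has_riemann_integral_imp_has_integral)
  obtain M where M: "M \<ge> 0" "\<And>x. x \<in> X \<Longrightarrow> norm (f x) \<le> M"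
    using riemann_integral_cube(2)[OF I X] by blast
  obtain c where c: "c > 0" "\<And>N. c * real N ^ Suc CARD('n) \<le> real (count_den_le X N)"
    using count_den_le_ge[OF X] by blast
  let ?p = "Suc CARD('n)"
  define \<kappa> where "\<kappa> s = den (u s)" for s
  define F where "F N = (\<Sum>k=1..N. \<Sum>x\<in>den_points X k. f x - I)" for N
  define W where "W N = (\<Union>k\<in>{1..N}. den_points X k)" for N
  have finW: "finite (W N)" for N
    unfolding W_def using finite_den_points(1)[OF _ X(2)] by auto
  have cardW: "card (W N) = count_den_le X N" for N
    unfolding W_def by (rule card_den_points_Un[OF X(2)])
  have \<kappa>1: "\<kappa> s \<ge> 1" if "s \<ge> 1" for s
    unfolding \<kappa>_def using uX[OF that] by (intro den_ge_1) simp
  have inj: "inj_on u {1..s}" for s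
    using u by (auto simp: bij_betw_def intro: inj_on_subset)
  have UW: "u ` {1..s} \<subseteq> W (\<kappa> s)" for s
    using uX \<kappa>1 mono by (auto simp: W_def den_points_def \<kappa>_def)
  have WU: "x \<in> u ` {1..s}" if x: "x \<in> W N" "den x < \<kappa> s" and s: "s \<ge> 1" for x s N
  proof -
    have "x \<in> X \<inter> rational_points" using x(1) by (auto simp: W_def den_points_def)
    then obtain r where r: "r \<ge> 1" "x = u r" using u by (auto simp: bij_betw_def)
    then have "r < s" using mono[of s r] x(2) s by (force simp: \<kappa>_def)
    then show ?thesis using r by simp
  qed
  \<comment> \<open>By injectivity, s distinct points fit into \<open>W (\<kappa> s)\<close>; hence
    \<open>\<kappa> s\<close> tends to infinity with s.\<close>
  have s_le: "real s \<le> 2 ^ CARD('n) * real (\<kappa> s) ^ ?p" for s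
  proof -
    have "s = card (u ` {1..s})" using card_image[OF inj] by simp
    also have "\<dots> \<le> card (W (\<kappa> s))" by (rule card_mono[OF finW UW])
    finally have "real s \<le> real (count_den_le X (\<kappa> s))" by (simp add: cardW)
    also have "\<dots> \<le> 2 ^ CARD('n) * real (\<kappa> s) ^ ?p" by (rule count_den_le_le[OF X(2)])
    finally show ?thesis .
  qed
  have \<kappa>_lim: "filterlim \<kappa> at_top sequentially"
    unfolding filterlim_at_top eventually_sequentially
  proof (intro allI)
    fix Z
    obtain s0 where s0: "2 ^ CARD('n) * real Z ^ ?p < real s0" using reals_Archimedean2 by blast
    have "Z \<le> \<kappa> s" if "s \<ge> s0" for s
    proof (rule ccontr)
      assume "\<not> Z \<le> \<kappa> s"
      then have "2 ^ CARD('n) * real (\<kappa> s) ^ ?p \<le> 2 ^ CARD('n) * real Z ^ ?p"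
        by (intro mult_left_mono power_mono) auto
      then show False using s_le[of s] s0 that by linarith
    qed
    then show "\<exists>s0. \<forall>s\<ge>s0. Z \<le> \<kappa> s" by blast
  qed
  \<comment> \<open>The error \<open>norm (F k)\<close> plus the incomplete block, (M + norm I)
    (2k)^n, divided by the lower bound c (k/2)^(n+1) for s.\<close>
  define \<phi> where "\<phi> k = (norm (F k) / real k ^ ?p + (M + norm I) * 2 ^ CARD('n) * (1 / real k)) * (2 ^ ?p / c)" for k
  have "\<phi> \<longlonglongrightarrow> (0 + (M + norm I) * 2 ^ CARD('n) * 0) * (2 ^ ?p / c)"
    unfolding \<phi>_def F_def
    by (intro tendsto_intros lim_1_over_n sum_den_le_tendsto_0[OF I X])
  then have "\<phi> \<longlonglongrightarrow> 0" by simp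
  from filterlim_compose[OF this \<kappa>_lim] have \<phi>_lim: "(\<lambda>s. \<phi> (\<kappa> s)) \<longlonglongrightarrow> 0" .
  have bound: "norm ((\<Sum>r=1..s. f (u r)) / of_nat s - I) \<le> \<phi> (\<kappa> s)"
    if s: "s \<ge> 1" and k: "\<kappa> s \<ge> 2" for s
  proof -
    define k where "k = \<kappa> s"
    define U where "U = u ` {1..s}"
    have k2: "k \<ge> 2" using k by (simp add: k_def)
    have U: "U \<subseteq> W k" "finite U" "card U = s"
      using UW card_image[OF inj, of s] by (auto simp: U_def k_def)
    have rest: "W k - U \<subseteq> den_points X k"
    proof
      fix x assume x: "x \<in> W k - U"
      then have "\<not> den x < k" using WU[of x k s] s by (auto simp: U_def k_def)
      then show "x \<in> den_points X k" using x by (auto simp: W_def den_points_def)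
    qed
    \<comment> \<open>This inequality is why the bound is claimed only for \<open>\<kappa> s\<close>
      >= 2, which holds eventually.\<close>
    have "real (k - 1) \<ge> real k / 2" using k2 by (simp add: of_nat_diff)
    then have "c * (real k / 2) ^ ?p \<le> c * real (k - 1) ^ ?p"
      using c(1) by (intro mult_left_mono power_mono) auto
    also have "\<dots> \<le> real (card (W (k - 1)))" unfolding cardW by (rule c)
    also have "card (W (k - 1)) \<le> card U"
    proof (rule card_mono[OF U(2)], rule subsetI)
      fix x assume x: "x \<in> W (k - 1)"
      then have "den x < k" using k2 by (auto simp: W_def den_points_def)
      then show "x \<in> U" using WU x s by (auto simp: U_def k_def)
    qed
    finally have s_ge: "c / 2 ^ ?p * real k ^ ?p \<le> real s"
      using U(3) by (simp only: power_divide) simp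
    have "(\<Sum>r=1..s. f (u r) - I) = (\<Sum>x\<in>U. f x - I)"
      unfolding U_def by (subst sum.reindex[OF inj]) simp
    also have "\<dots> = F k - (\<Sum>x\<in>W k - U. f x - I)"
    proof -
      have "F k = (\<Sum>x\<in>W k. f x - I)"
        unfolding F_def W_def by (rule sum_den_points_Un[OF X(2), symmetric])
      also have "\<dots> = (\<Sum>x\<in>W k - U. f x - I) + (\<Sum>x\<in>U. f x - I)"
        by (rule sum.subset_diff[OF U(1) finW])
      finally show ?thesis by simp
    qed
    finally have "norm (\<Sum>r=1..s. f (u r) - I) \<le> norm (F k) + norm (\<Sum>x\<in>W k - U. f x - I)"
      by (metis norm_triangle_ineq4)
    also have "norm (\<Sum>x\<in>W k - U. f x - I) \<le> real (card (W k - U)) * (M + norm I)"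
    proof (rule sum_norm_bound)
      fix x assume "x \<in> W k - U"
      then show "norm (f x - I) \<le> M + norm I"
        using norm_triangle_ineq4[of "f x" I] M(2)[of x] rest by (auto simp: den_points_def)
    qed
    also have "\<dots> \<le> (2 * real k) ^ CARD('n) * (M + norm I)"
    proof (rule mult_right_mono)
      have k1: "k \<ge> 1" using k2 by simp
      have "card (W k - U) \<le> card (den_points X k)"
        using card_mono[OF finite_den_points(1)[OF k1 X(2)] rest] .
      then have "real (card (W k - U)) \<le> real (card (den_points X k))" by simp
      also have "\<dots> \<le> (2 * real k) ^ CARD('n)" by (rule finite_den_points(2)[OF k1 X(2)])
      finally show "real (card (W k - U)) \<le> (2 * real k) ^ CARD('n)" .
    qed (use M in simp)
    also have "norm (F k) + (2 * real k) ^ CARD('n) * (M + norm I) = \<phi> k * (c / 2 ^ ?p * real k ^ ?p)"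
      unfolding \<phi>_def using k2 c(1) by (simp add: field_simps power_mult_distrib)
    also have "\<dots> \<le> \<phi> k * real s"
      using M(1) c(1) by (intro mult_left_mono s_ge) (auto simp: \<phi>_def)
    finally have "norm (\<Sum>r=1..s. f (u r) - I) / real s \<le> \<phi> k"
      using s by (simp add: divide_le_eq)
    moreover have "(\<Sum>r=1..s. f (u r)) / of_nat s - I = (\<Sum>r=1..s. f (u r) - I) / of_nat s"
      using s by (simp add: sum_subtractf diff_divide_distrib)
    ultimately show ?thesis by (simp add: norm_divide k_def)
  qed
  have "\<forall>\<^sub>F s in sequentially. \<kappa> s \<ge> 2" using \<kappa>_lim unfolding filterlim_at_top by blast
  then have "\<forall>\<^sub>F s in sequentially. norm ((\<Sum>r=1..s. f (u r)) / of_nat s - I) \<le> \<phi> (\<kappa> s)"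
    using eventually_ge_at_top[of 1] by eventually_elim (rule bound)
  then have "(\<lambda>s. (\<Sum>r=1..s. f (u r)) / of_nat s - I) \<longlonglongrightarrow> 0"
    using \<phi>_lim by (rule Lim_null_comparison)
  then show "(\<lambda>s. (\<Sum>r=1..s. f (u r)) / of_nat s) \<longlonglongrightarrow> integral X f"
    unfolding int by (simp only: LIM_zero_iff)
qed

theorem theorem1p3:
  fixes X :: "(real ^ 'n) set" and u :: "nat \<Rightarrow> real ^ 'n"
  assumes "X = half_open_cube \<or> X = closed_cube"
    and "bij_betw u {1..} (X \<inter> rational_points)"
    and "\<And>r s. 1 \<le> r \<Longrightarrow> r \<le> s \<Longrightarrow> den (u r) \<le> den (u s)"
  shows "uniformly_distributed u X"
  by (rule uniformly_distributed_den_enumeration[OF _ _ assms(2,3)])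
    (use assms(1) half_open_subset_closed in auto)

end
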